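(* Let $\eta\in\mathbb{R}$ and $L\in\mathbb{R}$ with $-1\neq L>-3/2$ if $\eta\ne0$, and $L>-3/2$ if $\eta=0$. Let $\{Q_k(n,L;\eta);\ k\in\mathbb{Z}_+\}$ be the sequence of monic polynomials in the variable $\eta$ defined by the recurrence $$Q_{k+1}(n,L;\eta)=\eta\,Q_k(n,L;\eta)-h_k(n,L)\,Q_{k-1}(n,L;\eta)\quad\text{for }k\in\mathbb{Z}_+,$$ with the initial conditions $Q_{-1}(n,L;\eta)=0$, $Q_0(n,L;\eta)=1$, where $$h_k(n,L)=\frac{k(2L+k+1)(2n-k+2)(2L+2n-k+3)}{4(2n-2k+1)(2n-2k+3)},\qquad k\in\mathbb{Z}_+.$$ Then the coefficients $c_k(n,L,\eta)$ in the expansion $P_n^{(L)}(\eta;z)=\sum_{k=0}^nc_k(n,L,\eta)z^{n-k}$, $n\in\mathbb{Z}_+$, fulfill $$c_k(n,L,\eta)=\frac{\sqrt{2L+2n+3}}{(L+1)\sqrt{2L+3}}\left|\frac{\Gamma(L+2+i\eta)}{\Gamma(L+n+2+i\eta)}\right|\frac{\Gamma(2n-k+2)\,\Gamma(2L+2n-k+3)}{\Gamma(2n-2k+2)\,\Gamma(2L+k+2)}\cdot\frac{2^{-n+k-1}}{k!}\,Q_k(n,L;\eta)$$ for $k=0,1,2,\dots,n$.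
   Context: $\mathbb{Z}_+=\{0,1,2,\dots\}$. Put $$w_n=\frac{\sqrt{(n+1)^2+\eta^2}}{(n+1)\sqrt{(2n+1)(2n+3)}},\qquad \lambda_n=-\frac{\eta}{n(n+1)}$$ for indices $n=L+1,L+2,\dots$ (with $\lambda_n=0$ for all $n$ if $\eta=0$). The polynomials $P_n^{(L)}(\eta;z)$ in $z$ are given by $P_{-1}^{(L)}=0$, $P_0^{(L)}=1$ and $$zP_n^{(L)}(\eta;z)=w_{L+n}P_{n-1}^{(L)}(\eta;z)+\lambda_{L+n+1}P_n^{(L)}(\eta;z)+w_{L+n+1}P_{n+1}^{(L)}(\eta;z),\quad n\in\mathbb{Z}_+$$ (for $n=0$ the first term on the right is absent). In the case $L=-1$, $\eta=0$ the right-hand side of the formula for $c_k$ is understood as the limit $L\to-1$ with $\eta=0$. *)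

theory Defs
  imports "HOL-Analysis.Analysis" "HOL-Computational_Algebra.Polynomial"
begin

text \<open>
  The Jacobi coefficients are indexed by a real number \<open>\<nu>\<close>, since they are evaluated at
  \<open>L + n\<close> with \<open>L\<close> real. As division by zero yields zero, \<open>coulomb_lambda 0 \<nu> = 0\<close> holds for
  every \<open>\<nu>\<close>, including \<open>\<nu> = 0\<close>, which occurs for \<open>L = -1\<close>.
\<close>

definition coulomb_w :: "real \<Rightarrow> real \<Rightarrow> real" where
  "coulomb_w \<eta> \<nu> = sqrt ((\<nu> + 1)\<^sup>2 + \<eta>\<^sup>2) / ((\<nu> + 1) * sqrt ((2 * \<nu> + 1) * (2 * \<nu> + 3)))"

definition coulomb_lambda :: "real \<Rightarrow> real \<Rightarrow> real" where
  "coulomb_lambda \<eta> \<nu> = - \<eta> / (\<nu> * (\<nu> + 1))"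

text \<open>
  The polynomials \<open>P\<^sub>n\<close> in the variable \<open>z\<close>: the three-term recurrence solved for the term of
  highest index. The original form of the recurrence is recovered below.
\<close>

fun coulomb_P :: "real \<Rightarrow> real \<Rightarrow> nat \<Rightarrow> real poly" where
  "coulomb_P L \<eta> 0 = 1"
| "coulomb_P L \<eta> (Suc 0) =
     smult (1 / coulomb_w \<eta> (L + 1)) ([:- coulomb_lambda \<eta> (L + 1), 1:] * coulomb_P L \<eta> 0)"
| "coulomb_P L \<eta> (Suc (Suc n)) =
     smult (1 / coulomb_w \<eta> (L + real (Suc n) + 1))
       ([:- coulomb_lambda \<eta> (L + real (Suc n) + 1), 1:] * coulomb_P L \<eta> (Suc n)
        - smult (coulomb_w \<eta> (L + real (Suc n))) (coulomb_P L \<eta> n))"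

definition coulomb_c :: "nat \<Rightarrow> nat \<Rightarrow> real \<Rightarrow> real \<Rightarrow> real" where
  "coulomb_c k n L \<eta> = coeff (coulomb_P L \<eta> n) (n - k)"

definition coulomb_h :: "nat \<Rightarrow> nat \<Rightarrow> real \<Rightarrow> real" where
  "coulomb_h k n L =
     real k * (2 * L + real k + 1) * (2 * real n - real k + 2) * (2 * L + 2 * real n - real k + 3)
     / (4 * (2 * real n - 2 * real k + 1) * (2 * real n - 2 * real k + 3))"

text \<open>
  The polynomials \<open>Q\<^sub>k\<close> in the variable \<open>\<eta>\<close>. The second equation is the instance \<open>k = 0\<close> of the
  recurrence with \<open>Q\<^sub>-\<^sub>1 = 0\<close>.
\<close>

fun coulomb_Q :: "nat \<Rightarrow> nat \<Rightarrow> real \<Rightarrow> real poly" where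
  "coulomb_Q 0 n L = 1"
| "coulomb_Q (Suc 0) n L = [:0, 1:] * coulomb_Q 0 n L"
| "coulomb_Q (Suc (Suc k)) n L =
     [:0, 1:] * coulomb_Q (Suc k) n L - smult (coulomb_h (Suc k) n L) (coulomb_Q k n L)"

text \<open>
  The formula is meaningful for \<open>L \<noteq> -1\<close> only. For \<open>L = -1\<close> and \<open>\<eta> = 0\<close> its value at \<open>L = -1\<close> is
  an artefact of division by zero; the limit \<open>L \<rightarrow> -1\<close> with \<open>\<eta> = 0\<close> has to be taken instead.
\<close>

definition coulomb_c_formula :: "nat \<Rightarrow> nat \<Rightarrow> real \<Rightarrow> real \<Rightarrow> real" where
  "coulomb_c_formula k n L \<eta> =
     sqrt (2 * L + 2 * real n + 3) / ((L + 1) * sqrt (2 * L + 3))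
     * cmod (Gamma (Complex (L + 2) \<eta>) / Gamma (Complex (L + real n + 2) \<eta>))
     * (Gamma (2 * real n - real k + 2) * Gamma (2 * L + 2 * real n - real k + 3)
        / (Gamma (2 * real n - 2 * real k + 2) * Gamma (2 * L + real k + 2)))
     * (2 powi (- int n + int k - 1) / fact k)
     * poly (coulomb_Q k n L) \<eta>"

lemma coulomb_w_pos:
  assumes "\<nu> > - 1 / 2"
  shows "coulomb_w \<eta> \<nu> > 0"
proof -
  have "(\<nu> + 1)\<^sup>2 > 0" using assms by simp
  hence "(\<nu> + 1)\<^sup>2 + \<eta>\<^sup>2 > 0" by (simp add: add_pos_nonneg)
  moreover have "(2 * \<nu> + 1) * (2 * \<nu> + 3) > 0" using assms by simp
  ultimately show ?thesis using assms by (simp add: coulomb_w_def)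
qed

lemma coulomb_P_recurrence:
  assumes "L > - 3 / 2"
  shows "z * poly (coulomb_P L \<eta> n) z =
           (if n = 0 then 0 else coulomb_w \<eta> (L + real n) * poly (coulomb_P L \<eta> (n - 1)) z)
           + coulomb_lambda \<eta> (L + real n + 1) * poly (coulomb_P L \<eta> n) z
           + coulomb_w \<eta> (L + real n + 1) * poly (coulomb_P L \<eta> (n + 1)) z"
proof -
  have "coulomb_w \<eta> (L + real n + 1) > 0"
    using assms by (intro coulomb_w_pos) simp
  thus ?thesis
    by (cases n) (simp_all add: algebra_simps)
qed

lemma degree_coulomb_P_le: "degree (coulomb_P L \<eta> n) \<le> n"
proof (induction L \<eta> n rule: coulomb_P.induct)
  case (3 L \<eta> n)
  have "degree ([:- coulomb_lambda \<eta> (L + real (Suc n) + 1), 1:] * coulomb_P L \<eta> (Suc n)) \<le> Suc (Suc n)"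
    using degree_mult_le[of "[:- coulomb_lambda \<eta> (L + real (Suc n) + 1), 1:]" "coulomb_P L \<eta> (Suc n)"]
      3(1) by simp
  moreover have "degree (smult (coulomb_w \<eta> (L + real (Suc n))) (coulomb_P L \<eta> n)) \<le> Suc (Suc n)"
    using degree_smult_le[of "coulomb_w \<eta> (L + real (Suc n))" "coulomb_P L \<eta> n"] 3(2) by linarith
  ultimately show ?case
    unfolding coulomb_P.simps by (rule order_trans[OF degree_smult_le degree_diff_le])
qed auto

lemma coulomb_P_expansion:
  "poly (coulomb_P L \<eta> n) z = (\<Sum>k\<le>n. coulomb_c k n L \<eta> * z ^ (n - k))"
proof -
  have "poly (coulomb_P L \<eta> n) z = (\<Sum>i\<le>n. coeff (coulomb_P L \<eta> n) i * z ^ i)"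
    unfolding poly_altdef using degree_coulomb_P_le[of L \<eta> n]
    by (intro sum.mono_neutral_left) (auto simp: coeff_eq_0 not_le)
  also have "\<dots> = (\<Sum>k\<le>n. coeff (coulomb_P L \<eta> n) (n - k) * z ^ (n - k))"
    by (rule sum.reindex_bij_witness[of _ "\<lambda>k. n - k" "\<lambda>k. n - k"]) auto
  finally show ?thesis by (simp add: coulomb_c_def)
qed

lemma coulomb_Q_monic: "degree (coulomb_Q k n L) = k \<and> lead_coeff (coulomb_Q k n L) = 1"
proof (induction k n L rule: coulomb_Q.induct)
  case (3 k n L)
  let ?p = "[:0, 1:] * coulomb_Q (Suc k) n L"
  let ?q = "smult (coulomb_h (Suc k) n L) (coulomb_Q k n L)"
  have ne: "coulomb_Q (Suc k) n L \<noteq> 0" using 3(1) by force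
  have p: "degree ?p = Suc (Suc k)" "lead_coeff ?p = 1"
    using 3(1) ne by (auto simp: degree_pCons_eq simp del: coulomb_Q.simps)
  have q: "degree ?q < degree ?p"
    using 3(2) p(1) le_less_trans[OF degree_smult_le, of "coulomb_Q k n L" "Suc (Suc k)"] by simp
  have "degree (?p + - ?q) = degree ?p" by (rule degree_add_eq_left) (use q in simp)
  hence d: "degree (?p - ?q) = Suc (Suc k)" using p(1) by simp
  have "coeff ?q (Suc (Suc k)) = 0" using q p(1) by (intro coeff_eq_0) simp
  with d p show ?case unfolding coulomb_Q.simps by (simp del: mult_pCons_left)
qed auto

end

theory Submission
  imports Defs
begin

text \<open>
  Comparing coefficients in the recurrence of \<open>P\<^sub>n\<close> and cancelling Gamma functions, the formula for
  \<open>c\<^sub>k\<close> becomes a relation between \<open>Q\<^sub>k(n + 1)\<close>, \<open>Q\<^sub>k(n)\<close>, \<open>\<eta> Q\<^sub>k\<^sub>-\<^sub>1(n)\<close> and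
  \<open>(\<eta>\<^sup>2 + (L + n + 1)\<^sup>2) Q\<^sub>k\<^sub>-\<^sub>2(n - 1)\<close>. All these polynomials are reduced to the same parameter \<open>n\<close>
  by the two-term connection formula \<open>Q\<^sub>k(n + 1) = Q\<^sub>k(n) + a Q\<^sub>k\<^sub>-\<^sub>2(n)\<close>, and the relation then follows
  from the recurrence in \<open>k\<close>. For \<open>L = -1\<close> and \<open>\<eta> = 0\<close> no Gamma asymptotics are needed: the formula
  holds for \<open>M \<noteq> -1\<close> close to \<open>-1\<close>, and the coefficients of \<open>P\<^sub>n\<close> are continuous in \<open>M\<close>.
\<close>

section \<open>Connection formula and contiguous relations for the polynomials
  \<open>Q\<^sub>k\<close>\<close>

abbreviation Qval :: "nat \<Rightarrow> nat \<Rightarrow> real \<Rightarrow> real \<Rightarrow> real" where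
  "Qval k n L \<eta> \<equiv> poly (coulomb_Q k n L) \<eta>"

lemma Qval_rec:
  "Qval (Suc (Suc k)) n L \<eta> = \<eta> * Qval (Suc k) n L \<eta> - coulomb_h (Suc k) n L * Qval k n L \<eta>"
  by simp

declare coulomb_Q.simps(3) [simp del]

text \<open>Apart from the constant 4, the denominator factors of \<open>coulomb_h\<close> and
  \<open>Q_connection\<close> are odd integers, hence nonzero even for \<open>k > n\<close>.\<close>

lemma odd_diff_nonzero:
  assumes "odd c"
  shows "2 * real n - 2 * real k + of_int c \<noteq> 0"
proof
  assume "2 * real n - 2 * real k + of_int c = 0"
  hence "of_int (2 * int n - 2 * int k + c) = (0 :: real)" by simp
  hence "2 * int n - 2 * int k + c = 0" by (simp only: of_int_eq_0_iff)
  with assms show False by presburger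
qed

text \<open>
  The coefficient in \<open>Q\<^sub>k(n + 1) = Q\<^sub>k(n) + a Q\<^sub>k\<^sub>-\<^sub>2(n)\<close>. Comparing the three-term recurrences at
  \<open>n\<close> and \<open>n + 1\<close> forces \<open>Q_connection_step\<close> and \<open>Q_connection_mult\<close>, whose solution is this product.
\<close>

definition Q_connection :: "nat \<Rightarrow> nat \<Rightarrow> real \<Rightarrow> real" where
  "Q_connection k n L =
     real k * (real k - 1) * (2 * L + real k + 1) * (2 * L + real k)
     / (4 * (2 * real n - 2 * real k + 3) * (2 * real n - 2 * real k + 5))"

lemma Q_connection_step:
  "coulomb_h (Suc k) n L + Q_connection (Suc k) n L
     = Q_connection (Suc (Suc k)) n L + coulomb_h (Suc k) (Suc n) L"
proof -
  define d where "d = 2 * real n - 2 * real k"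
  have n: "2 * real n = d + 2 * real k" by (simp add: d_def)
  have d: "d - 1 \<noteq> 0" "d + 1 \<noteq> 0" "d + 3 \<noteq> 0"
    using odd_diff_nonzero[of "-1" n k] odd_diff_nonzero[of 1 n k] odd_diff_nonzero[of 3 n k]
    by (simp_all add: d_def)
  have e: "2 * real n - 2 * real (Suc k) + 1 = d - 1" "2 * real n - 2 * real (Suc k) + 3 = d + 1"
    "2 * real n - 2 * real (Suc k) + 5 = d + 3" "2 * real n - 2 * real (Suc (Suc k)) + 3 = d - 1"
    "2 * real n - 2 * real (Suc (Suc k)) + 5 = d + 1" "2 * real (Suc n) - 2 * real (Suc k) + 1 = d + 1"
    "2 * real (Suc n) - 2 * real (Suc k) + 3 = d + 3"
    by (simp_all add: d_def)
  have r: "real (Suc k) = real k + 1" "real (Suc (Suc k)) = real k + 2"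
    "2 * real (Suc n) = d + 2 * real k + 2" by (simp_all add: d_def)
  show ?thesis
    unfolding coulomb_h_def Q_connection_def e unfolding r n
    using d by (simp add: divide_simps) algebra
qed

lemma Q_connection_mult:
  "Q_connection (Suc (Suc (Suc k))) n L * coulomb_h (Suc k) n L
     = coulomb_h (Suc (Suc (Suc k))) (Suc n) L * Q_connection (Suc (Suc k)) n L"
proof -
  have r: "real (Suc k) = real k + 1" "real (Suc (Suc k)) = real k + 2"
    "real (Suc (Suc (Suc k))) = real k + 3" "real (Suc n) = real n + 1" by simp_all
  \<comment> \<open>Numerators and denominators of the two products agree separately as
    polynomials.\<close>
  show ?thesis
    unfolding coulomb_h_def Q_connection_def r times_divide_times_eq
    by (rule arg_cong2[where f = "(/)"]; algebra)
qed

lemma Q_connection_zero: "Q_connection (Suc 0) n L = 0"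
  by (simp add: Q_connection_def)

text \<open>In the induction step both hypotheses are inserted into the recurrence at
  \<open>n + 1\<close>, and the recurrence at \<open>n\<close> eliminates
  \<open>\<eta> * Qval (Suc k) n L \<eta>\<close>. The coefficient of
  \<open>Q\<^sub>k\<^sub>+\<^sub>2(n)\<close> then cancels by \<open>Q_connection_step\<close>, that
  of \<open>Q\<^sub>k(n)\<close> by \<open>Q_connection_mult\<close>.\<close>

lemma Q_connection_formula:
  "Qval (Suc (Suc k)) (Suc n) L \<eta>
     = Qval (Suc (Suc k)) n L \<eta> + Q_connection (Suc (Suc k)) n L * Qval k n L \<eta>"
proof (induction k rule: induct_nat_012)
  case 0
  show ?case
    using Q_connection_step[of 0 n L] Q_connection_zero[of n L] by (simp add: Qval_rec)
next
  case 1
  show ?case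
    using Q_connection_step[of 0 n L] Q_connection_step[of 1 n L] Q_connection_zero[of n L]
    by (simp add: Qval_rec) algebra
next
  case (ge2 k)
  show ?case
    unfolding Qval_rec[of "Suc (Suc k)"] ge2
    using Qval_rec[of k n L \<eta>] Q_connection_mult[of k n L] Q_connection_step[of "Suc (Suc k)" n L]
    by algebra
qed

lemma Q_index_shift_coeff:
  "(2 * real n - real k + 1) * (2 * L + 2 * real n - real k + 2) * Q_connection (Suc (Suc k)) n L
     = (real k + 2) * (2 * L + real k + 3) * coulomb_h (Suc k) n L"
  unfolding coulomb_h_def Q_connection_def by (simp add: algebra_simps)

text \<open>For \<open>k = Suc j\<close>, the connection formula and the recurrence reduce
  everything to \<open>Q\<^sub>j\<^sub>+\<^sub>2(n)\<close> and \<open>Q\<^sub>j(n)\<close>. The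
  first coefficients agree as polynomials, the second by \<open>Q_index_shift_coeff\<close>.\<close>

lemma Q_index_shift:
  "(2 * real n - real k + 2) * (2 * L + 2 * real n - real k + 3) * Qval (Suc k) (Suc n) L \<eta>
     = (2 * L + 2 * real n + 4) * (2 * real n - 2 * real k + 1) * Qval (Suc k) n L \<eta>
       + (real k + 1) * (2 * L + real k + 2) * \<eta> * Qval k n L \<eta>"
proof (cases k)
  case 0
  thus ?thesis by (simp add: algebra_simps)
next
  case (Suc j)
  have k: "real k = real j + 1" by (simp add: Suc)
  show ?thesis
    unfolding k unfolding Suc Q_connection_formula
    using Qval_rec[of j n L \<eta>] Q_index_shift_coeff[of n j L]
    by algebra
qed

lemma Q_three_levels_coeff:
  "2 * (2 * real n - 2 * real k + 1) * (coulomb_h (Suc k) n L - Q_connection (Suc (Suc k)) n L)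
     = (L + real n + 2) * (2 * L + real k + 2) * (real k + 1)"
proof -
  define d where "d = 2 * real n - 2 * real k"
  have n: "real n = d / 2 + real k" by (simp add: d_def field_simps)
  have d: "d - 1 \<noteq> 0" "d + 1 \<noteq> 0"
    using odd_diff_nonzero[of "-1" n k] odd_diff_nonzero[of 1 n k]
    by (simp_all add: d_def)
  have e: "2 * real n - 2 * real (Suc k) + 1 = d - 1" "2 * real n - 2 * real (Suc k) + 3 = d + 1"
    "2 * real n - 2 * real (Suc (Suc k)) + 3 = d - 1" "2 * real n - 2 * real (Suc (Suc k)) + 5 = d + 1"
    "2 * real n - 2 * real k + 1 = d + 1"
    by (simp_all add: d_def)
  have r: "real (Suc k) = real k + 1" "real (Suc (Suc k)) = real k + 2" by simp_all
  show ?thesis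
    unfolding coulomb_h_def Q_connection_def e unfolding r n
    using d by (simp add: divide_simps) algebra
qed

text \<open>This is the source of the numerator of the squared \<open>coulomb_w\<close>:
  \<open>\<eta>\<^sup>2\<close> comes from multiplying \<open>Q_index_shift\<close> by
  \<open>\<eta>\<close>, and \<open>(L + n + 2)\<^sup>2\<close> from the difference of
  \<open>coulomb_h\<close> and \<open>Q_connection\<close>.\<close>

lemma Q_three_levels:
  "(2 * real n - real k + 2) * (2 * L + 2 * real n - real k + 3) * \<eta> * Qval (Suc k) (Suc n) L \<eta>
     = 2 * (L + real n + 2) * (2 * real n - 2 * real k + 1) * Qval (Suc (Suc k)) (Suc n) L \<eta>
       + ((L + real n + 2)\<^sup>2 + \<eta>\<^sup>2) * (2 * L + real k + 2) * (real k + 1) * Qval k n L \<eta>"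
  unfolding Q_connection_formula
  using Q_index_shift[of n k L \<eta>] Qval_rec[of k n L \<eta>] Q_three_levels_coeff[of n k L]
  by algebra

text \<open>
  What the recurrence of the coefficients becomes after cancelling Gamma functions and square roots.
\<close>

lemma Q_coefficient_recurrence:
  fixes n k :: nat and L \<eta> :: real
  assumes "k \<le> Suc n" and s: "s = L + real n + 1"
  shows "s * (s + 1) * (2 * s + 1) * (2 * (2 * real n - 2 * real k + 3) * (2 * real n - 2 * real k + 2))
           * Qval k n L \<eta>
       = (s\<^sup>2 + \<eta>\<^sup>2) * (s + 1) * ((2 * L + real k + 1) * (2 * L + real k) * real k * (real k - 1))
           * (if k < 2 then 0 else Qval (k - 2) (n - 1) L \<eta>)
         - \<eta> * (2 * s + 1) * ((2 * real n - real k + 2) * (2 * L + 2 * real n - real k + 3)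
             * (2 * L + real k + 1) * real k) * (if k = 0 then 0 else Qval (k - 1) n L \<eta>)
         + s * ((2 * real n - real k + 3) * (2 * real n - real k + 2) * (2 * L + 2 * real n - real k + 4)
             * (2 * L + 2 * real n - real k + 3)) * Qval k (Suc n) L \<eta>"
proof -
  \<comment> \<open>The bound on \<open>k\<close> makes \<open>n\<close> positive as soon as
    \<open>k \<ge> 2\<close>, so \<open>n - 1\<close> is a true predecessor there.\<close>
  consider "k = 0" | "k = 1" | j m where "k = Suc (Suc j)" "n = Suc m"
    using assms(1) by (cases k; cases "k - 1"; cases n) auto
  thus ?thesis
  proof cases
    case 1
    show ?thesis unfolding 1 by (simp add: s) algebra
  next
    case 2
    show ?thesis unfolding 2 by (simp add: s) algebra
  next
    case 3
    have r: "real n = real m + 1" "real k = real j + 2" "(k < 2) = False" "(k = 0) = False" "k - 2 = j"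
        "k - 1 = Suc j" "n - 1 = m" by (auto simp: 3)
    have shift: "(2 * (real m + 1) - (real j + 1) + 2) * (2 * L + 2 * (real m + 1) - (real j + 1) + 3)
          * Qval (Suc (Suc j)) (Suc (Suc m)) L \<eta>
        = (2 * L + 2 * (real m + 1) + 4) * (2 * (real m + 1) - 2 * (real j + 1) + 1) * Qval (Suc (Suc j)) (Suc m) L \<eta>
          + (real j + 2) * (2 * L + real j + 3) * \<eta> * Qval (Suc j) (Suc m) L \<eta>"
      using Q_index_shift[of "Suc m" "Suc j" L \<eta>] by (simp add: algebra_simps)
    \<comment> \<open>\<open>shift\<close> eliminates
      \<open>Q\<^sub>j\<^sub>+\<^sub>2(m + 2)\<close> and \<open>Q_three_levels\<close> eliminates
      \<open>Q\<^sub>j(m)\<close>; only the two values at level \<open>m + 1\<close> remain.\<close>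
    show ?thesis
      unfolding s r if_False unfolding 3 using shift Q_three_levels[of m j L \<eta>] by algebra
  qed
qed

section \<open>Splitting the formula and shifting its real Gamma quotients\<close>

definition gamma_factor :: "nat \<Rightarrow> nat \<Rightarrow> real \<Rightarrow> real" where
  "gamma_factor k n L =
     Gamma (2 * real n - real k + 2) * Gamma (2 * L + 2 * real n - real k + 3)
       / (Gamma (2 * real n - 2 * real k + 2) * Gamma (2 * L + real k + 2))
     * (2 powi (- int n + int k - 1) / fact k)"

definition coulomb_norm :: "nat \<Rightarrow> real \<Rightarrow> real \<Rightarrow> real" where
  "coulomb_norm n L \<eta> =
     sqrt (2 * L + 2 * real n + 3) / ((L + 1) * sqrt (2 * L + 3))
     * cmod (Gamma (Complex (L + 2) \<eta>) / Gamma (Complex (L + real n + 2) \<eta>))"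

text \<open>
  A common factor of \<open>gamma_factor k n\<close>, \<open>gamma_factor k (n + 1)\<close>, \<open>gamma_factor (k - 1) n\<close> and
  \<open>gamma_factor (k - 2) (n - 1)\<close>, with polynomial cofactors. For \<open>k = n + 1\<close> both
  \<open>Gamma 0\<close> and \<open>1 / 0\<close> are zero in \<open>gamma_factor k n\<close>, in agreement with the vanishing coefficient.
\<close>

definition gamma_base :: "nat \<Rightarrow> nat \<Rightarrow> real \<Rightarrow> real" where
  "gamma_base k n L =
     Gamma (2 * real n - real k + 2) * Gamma (2 * L + 2 * real n - real k + 3)
       * rGamma (2 * real n - 2 * real k + 4) * rGamma (2 * L + real k + 2)
     * (2 powi (- int n + int k - 2) / fact k)"

lemma coulomb_c_formula_eq:
  "coulomb_c_formula k n L \<eta> = coulomb_norm n L \<eta> * gamma_factor k n L * Qval k n L \<eta>"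
  by (simp add: coulomb_c_formula_def gamma_factor_def coulomb_norm_def)

text \<open>The functional equation of \<open>rGamma\<close> also holds at the poles of Gamma, such
  as \<open>2 * n - 2 * k + 2 = 0\<close> for \<open>k = n + 1\<close>.\<close>

lemma gamma_factor_alt:
  "gamma_factor k n L =
     Gamma (2 * real n - real k + 2) * Gamma (2 * L + 2 * real n - real k + 3)
       * rGamma (2 * real n - 2 * real k + 2) * rGamma (2 * L + real k + 2)
     * (2 powi (- int n + int k - 1) / fact k)"
  by (simp add: gamma_factor_def Gamma_def field_simps)

lemma rGamma_plus2: "rGamma x = x * (x + 1) * rGamma (x + 2 :: real)"
  using rGamma_plus1[of x] rGamma_plus1[of "x + 1"] by (simp add: add.assoc mult.assoc)

lemma gamma_factor_base:
  "gamma_factor k n L = 2 * (2 * real n - 2 * real k + 3) * (2 * real n - 2 * real k + 2) * gamma_base k n L"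
proof -
  have "2 * real n - 2 * real k + 2 + 2 = 2 * real n - 2 * real k + 4"
    "2 * real n - 2 * real k + 2 + 1 = 2 * real n - 2 * real k + 3" by simp_all
  note rGamma_plus2[of "2 * real n - 2 * real k + 2", unfolded this]
  moreover have "2 powi (- int n + int k - 1) = 2 * (2 powi (- int n + int k - 2) :: real)"
    using power_int_add[of "2::real" "- int n + int k - 2" 1] by simp
  ultimately show ?thesis
    unfolding gamma_factor_alt gamma_base_def by simp
qed

text \<open>Negative arguments do occur: \<open>2 * L + 2\<close> lies in the interval from -1 to 0
  when \<open>- 3 / 2 < L < - 1\<close>.\<close>

lemma Gamma_plus1_real:
  "x > - 1 \<Longrightarrow> x \<noteq> 0 \<Longrightarrow> Gamma (x + 1) = x * Gamma (x :: real)"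
  by (intro Gamma_plus1) (auto elim!: nonpos_Ints_cases)

lemma Gamma_plus2_real:
  "x > - 1 \<Longrightarrow> x \<noteq> 0 \<Longrightarrow> Gamma (x + 2) = (x + 1) * x * Gamma (x :: real)"
  using Gamma_plus1_real[of x] Gamma_plus1_real[of "x + 1"] by (simp add: add.assoc)

lemma gamma_factor_Suc_base:
  assumes "k \<le> Suc n" "L > - 3 / 2" "L \<noteq> - 1"
  shows "gamma_factor k (Suc n) L
    = (2 * real n - real k + 3) * (2 * real n - real k + 2)
      * (2 * L + 2 * real n - real k + 4) * (2 * L + 2 * real n - real k + 3) * gamma_base k n L"
proof -
  define x where "x = 2 * real n - real k + 2"
  define y where "y = 2 * L + 2 * real n - real k + 3"
  have k: "real k \<le> real n + 1" using assms(1) by linarith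
  have x: "x > - 1" "x \<noteq> 0" using k by (simp_all add: x_def)
  have y: "y > - 1" using assms(2) k by (simp add: y_def)
  \<comment> \<open>The critical case is \<open>n = 0\<close>, \<open>k = 1\<close>, where
    \<open>y = 2 * L + 2\<close>; otherwise \<open>y \<ge> 2 * L + 3 > 0\<close>.\<close>
  have "y \<noteq> 0"
  proof (cases n)
    case 0
    thus ?thesis using assms k by (cases k) (auto simp: y_def)
  next
    case (Suc m)
    thus ?thesis using assms(2) k by (simp add: y_def)
  qed
  note G = Gamma_plus2_real[OF x] Gamma_plus2_real[OF y this]
  have e: "2 * real (Suc n) - real k + 2 = x + 2" "2 * L + 2 * real (Suc n) - real k + 3 = y + 2"
    "2 * real n - real k + 3 = x + 1" "2 * L + 2 * real n - real k + 4 = y + 1"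
    "2 * real n - real k + 2 = x" "2 * L + 2 * real n - real k + 3 = y"
    "2 * real (Suc n) - 2 * real k + 2 = 2 * real n - 2 * real k + 4"
    "- int (Suc n) + int k - 1 = - int n + int k - 2"
    by (simp_all add: x_def y_def)
  show ?thesis
    unfolding gamma_factor_alt gamma_base_def e G by simp
qed

lemma gamma_factor_pred_base:
  assumes "k \<le> n" "L > - 3 / 2" "L \<noteq> - 1"
  shows "gamma_factor k n L
    = (2 * real n - real k + 1) * (2 * L + 2 * real n - real k + 2) * (2 * L + real k + 2) * (real k + 1)
      * gamma_base (Suc k) n L"
proof -
  define x where "x = 2 * real n - real k + 1"
  define y where "y = 2 * L + 2 * real n - real k + 2"
  have k: "real k \<le> real n" using assms(1) by linarith
  have x: "x > - 1" "x \<noteq> 0" using k by (simp_all add: x_def)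
  have y: "y > - 1" using assms(2) k by (simp add: y_def)
  have "y \<noteq> 0"
  proof (cases n)
    case 0
    thus ?thesis using assms k by (auto simp: y_def)
  next
    case (Suc m)
    thus ?thesis using assms(2) k by (simp add: y_def)
  qed
  note G = Gamma_plus1_real[OF x] Gamma_plus1_real[OF y this]
  have R: "rGamma (2 * L + real k + 2) = (2 * L + real k + 2) * rGamma (2 * L + real k + 2 + 1)"
    by (rule rGamma_plus1[symmetric])
  have e: "2 * real n - real (Suc k) + 2 = x" "2 * L + 2 * real n - real (Suc k) + 3 = y"
    "2 * real n - real k + 2 = x + 1" "2 * L + 2 * real n - real k + 3 = y + 1"
    "2 * real n - real k + 1 = x" "2 * L + 2 * real n - real k + 2 = y"
    "2 * real n - 2 * real (Suc k) + 4 = 2 * real n - 2 * real k + 2"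
    "2 * L + real (Suc k) + 2 = 2 * L + real k + 2 + 1"
    "- int n + int (Suc k) - 2 = - int n + int k - 1"
    by (simp_all add: x_def y_def)
  have f: "fact (Suc k) = (real k + 1) * fact k"
    by (simp add: algebra_simps)
  show ?thesis
    unfolding gamma_factor_alt gamma_base_def e f G R by (simp add: divide_simps)
qed

text \<open>Passing from \<open>(k, n)\<close> to \<open>(k + 2, n + 1)\<close> preserves
  \<open>2 * n - k\<close>, hence both Gamma numerators; the cofactors come from one
  \<open>rGamma\<close> and the factorial.\<close>

lemma gamma_factor_pred_pred_base:
  "gamma_factor k n L
    = (2 * L + real k + 3) * (2 * L + real k + 2) * (real k + 2) * (real k + 1)
      * gamma_base (Suc (Suc k)) (Suc n) L"
proof -
  have e: "2 * real (Suc n) - real (Suc (Suc k)) + 2 = 2 * real n - real k + 2"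
    "2 * L + 2 * real (Suc n) - real (Suc (Suc k)) + 3 = 2 * L + 2 * real n - real k + 3"
    "2 * real (Suc n) - 2 * real (Suc (Suc k)) + 4 = 2 * real n - 2 * real k + 2"
    "2 * L + real (Suc (Suc k)) + 2 = 2 * L + real k + 2 + 2"
    "- int (Suc n) + int (Suc (Suc k)) - 2 = - int n + int k - 1"
    by simp_all
  have f: "fact (Suc (Suc k)) = (real k + 2) * (real k + 1) * fact k"
    by (simp add: algebra_simps)
  show ?thesis
    unfolding gamma_factor_alt gamma_base_def e f rGamma_plus2[of "2 * L + real k + 2"]
    by (simp add: divide_simps)
qed

section \<open>The complex Gamma quotient and the normalisation\<close>

lemma Complex_notin_nonpos_Ints: "x > 0 \<Longrightarrow> Complex x y \<notin> \<int>\<^sub>\<le>\<^sub>0"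
  by (auto elim!: nonpos_Ints_cases simp: complex_eq_iff)

lemma cmod_Gamma_Complex_plus1:
  assumes "x > 0"
  shows "cmod (Gamma (Complex (x + 1) y)) = sqrt (x\<^sup>2 + y\<^sup>2) * cmod (Gamma (Complex x y))"
proof -
  have "Complex x y + 1 = Complex (x + 1) y" by (simp add: complex_eq_iff)
  thus ?thesis
    using Gamma_plus1[OF Complex_notin_nonpos_Ints[OF assms, of y]]
    by (simp add: norm_mult complex_norm)
qed

text \<open>Raising \<open>n\<close> by one divides the Gamma quotient by the square root in the
  numerator of \<open>coulomb_w\<close>. In the first identity this root cancels, in the second it
  is squared, so rational factors remain.\<close>

lemma coulomb_norm_Suc:
  assumes "L > - 3 / 2"
  shows "coulomb_w \<eta> (L + real n + 1) * coulomb_norm (Suc n) L \<eta>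
           = coulomb_norm n L \<eta> / ((L + real n + 2) * (2 * L + 2 * real n + 3))" (is ?A)
    and "coulomb_w \<eta> (L + real n + 1) * coulomb_norm n L \<eta>
           = ((L + real n + 2)\<^sup>2 + \<eta>\<^sup>2) / ((L + real n + 2) * (2 * L + 2 * real n + 5)) * coulomb_norm (Suc n) L \<eta>" (is ?B)
proof -
  define r where "r = sqrt ((L + real n + 2)\<^sup>2 + \<eta>\<^sup>2)"
  define u where "u = sqrt (2 * L + 2 * real n + 3)"
  define v where "v = sqrt (2 * L + 2 * real n + 5)"
  define R where "R = cmod (Gamma (Complex (L + real n + 2) \<eta>))"
  have x: "L + real n + 2 > 0" using assms by linarith
  have r: "r > 0" "r\<^sup>2 = (L + real n + 2)\<^sup>2 + \<eta>\<^sup>2"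
    using x by (auto simp: r_def add_pos_nonneg)
  have u: "u > 0" "2 * L + 2 * real n + 3 = u\<^sup>2" and v: "v > 0" "2 * L + 2 * real n + 5 = v\<^sup>2"
    using assms by (auto simp: u_def v_def)
  have w: "coulomb_w \<eta> (L + real n + 1) = r / ((L + real n + 2) * (u * v))"
  proof -
    have "L + real n + 1 + 1 = L + real n + 2" "2 * (L + real n + 1) + 1 = 2 * L + 2 * real n + 3"
      "2 * (L + real n + 1) + 3 = 2 * L + 2 * real n + 5" by simp_all
    thus ?thesis by (simp only: coulomb_w_def r_def u_def v_def real_sqrt_mult)
  qed
  have "cmod (Gamma (Complex (L + real (Suc n) + 2) \<eta>)) = r * R"
    using cmod_Gamma_Complex_plus1[OF x, of \<eta>] by (simp add: r_def R_def algebra_simps)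
  hence G: "coulomb_norm (Suc n) L \<eta> = v / ((L + 1) * sqrt (2 * L + 3)) * (cmod (Gamma (Complex (L + 2) \<eta>)) / (r * R))"
    "coulomb_norm n L \<eta> = u / ((L + 1) * sqrt (2 * L + 3)) * (cmod (Gamma (Complex (L + 2) \<eta>)) / R)"
    by (simp_all add: coulomb_norm_def norm_divide R_def u_def v_def algebra_simps)
  show ?A ?B
    unfolding w G u v r(2)[symmetric] using r(1) u(1) v(1) x
    by (simp_all add: divide_simps power2_eq_square)
qed

section \<open>The common recurrence of the formula and the coefficients\<close>

text \<open>Each term is the common factor \<open>G * E\<close> times a rational cofactor and a
  value of \<open>Q\<close>; clearing denominators leaves
  \<open>Q_coefficient_recurrence\<close>.\<close>

lemma coulomb_c_formula_recurrence:
  assumes "k \<le> Suc n" "L > - 3 / 2" "L \<noteq> - 1"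
  shows "coulomb_w \<eta> (L + real n + 1) * coulomb_c_formula k (Suc n) L \<eta>
    = coulomb_c_formula k n L \<eta>
      - coulomb_lambda \<eta> (L + real n + 1) * (if k = 0 then 0 else coulomb_c_formula (k - 1) n L \<eta>)
      - coulomb_w \<eta> (L + real n) * (if k < 2 then 0 else coulomb_c_formula (k - 2) (n - 1) L \<eta>)"
proof -
  define s where "s = L + real n + 1"
  \<comment> \<open>For \<open>n = 0\<close> this is \<open>L + 1\<close>, which is nonzero but may
    be negative.\<close>
  have s: "s \<noteq> 0" "s + 1 > 0" "2 * s + 1 > 0"
    using assms(2,3) by (cases n; simp add: s_def)+
  define E where "E = gamma_base k n L"
  define G where "G = coulomb_norm n L \<eta>"
  define X where "X = (if k = 0 then 0 else Qval (k - 1) n L \<eta>)"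
  define Y where "Y = (if k < 2 then 0 else Qval (k - 2) (n - 1) L \<eta>)"
  define c1 where "c1 = (2 * real n - real k + 3) * (2 * real n - real k + 2)
      * (2 * L + 2 * real n - real k + 4) * (2 * L + 2 * real n - real k + 3)"
  define c2 where "c2 = 2 * (2 * real n - 2 * real k + 3) * (2 * real n - 2 * real k + 2)"
  define c3 where "c3 = (2 * real n - real k + 2) * (2 * L + 2 * real n - real k + 3)
      * (2 * L + real k + 1) * real k"
  define c4 where "c4 = (2 * L + real k + 1) * (2 * L + real k) * real k * (real k - 1)"
  have 1: "coulomb_w \<eta> (L + real n + 1) * coulomb_c_formula k (Suc n) L \<eta>
      = G / ((s + 1) * (2 * s + 1)) * (c1 * E) * Qval k (Suc n) L \<eta>"
  proof -
    have w: "coulomb_w \<eta> (L + real n + 1) * coulomb_norm (Suc n) L \<eta> = G / ((s + 1) * (2 * s + 1))"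
      using coulomb_norm_Suc(1)[OF assms(2), of \<eta> n] by (simp add: s_def G_def algebra_simps)
    show ?thesis
      unfolding coulomb_c_formula_eq w[symmetric] gamma_factor_Suc_base[OF assms] c1_def E_def
      by (simp only: mult.assoc)
  qed
  have 2: "coulomb_c_formula k n L \<eta> = G * (c2 * E) * Qval k n L \<eta>"
    by (simp add: coulomb_c_formula_eq gamma_factor_base G_def E_def c2_def)
  have 3: "(if k = 0 then 0 else coulomb_c_formula (k - 1) n L \<eta>)
      = G * (c3 * E) * X"
  proof (cases k)
    case (Suc j)
    have e: "2 * real n - real j + 1 = 2 * real n - real k + 2"
      "2 * L + 2 * real n - real j + 2 = 2 * L + 2 * real n - real k + 3"
      "2 * L + real j + 2 = 2 * L + real k + 1" "real j + 1 = real k" by (simp_all add: Suc)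
    have "gamma_factor j n L = c3 * E"
      using gamma_factor_pred_base[of j n L] assms
      unfolding e c3_def E_def by (simp add: Suc)
    thus ?thesis by (simp add: Suc coulomb_c_formula_eq G_def X_def)
  qed (simp add: X_def)
  have 4: "coulomb_w \<eta> (L + real n) * (if k < 2 then 0 else coulomb_c_formula (k - 2) (n - 1) L \<eta>)
      = (s\<^sup>2 + \<eta>\<^sup>2) / (s * (2 * s + 1)) * G * (c4 * E) * Y"
  proof (cases "k < 2")
    case False
    then obtain j m where jm: "k = Suc (Suc j)" "n = Suc m"
      using assms(1) by (cases k; cases "k - 1"; cases n) auto
    have w: "coulomb_w \<eta> (L + real n) * coulomb_norm m L \<eta> = (s\<^sup>2 + \<eta>\<^sup>2) / (s * (2 * s + 1)) * G"
      using coulomb_norm_Suc(2)[OF assms(2), of \<eta> m] by (simp add: s_def G_def jm algebra_simps)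
    have e: "2 * L + real j + 3 = 2 * L + real k + 1" "2 * L + real j + 2 = 2 * L + real k"
      "real j + 2 = real k" "real j + 1 = real k - 1" by (simp_all add: jm)
    have b: "gamma_factor j m L = c4 * E"
      using gamma_factor_pred_pred_base[of j m L] unfolding e c4_def E_def by (simp add: jm)
    have "coulomb_w \<eta> (L + real n) * coulomb_c_formula j m L \<eta>
      = (coulomb_w \<eta> (L + real n) * coulomb_norm m L \<eta>) * gamma_factor j m L * Qval j m L \<eta>"
      by (simp add: coulomb_c_formula_eq)
    also note w
    also note b
    finally show ?thesis by (simp add: jm Y_def)
  qed (simp add: Y_def)
  have 5: "coulomb_lambda \<eta> (L + real n + 1) = - \<eta> / (s * (s + 1))"
    by (simp add: coulomb_lambda_def s_def algebra_simps)
  show ?thesis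
    unfolding 1 2 3 4 5
    using Q_coefficient_recurrence[OF assms(1) s_def, of \<eta>, folded X_def Y_def c1_def c2_def c3_def c4_def] s
    by (simp add: divide_simps) algebra
qed

text \<open>Both sides are 1: the quotient of \<open>Gamma (2 * L + 3)\<close> by
  \<open>Gamma (2 * L + 2)\<close> is \<open>2 * (L + 1)\<close>, which cancels \<open>L + 1\<close>
  and the power of 2.\<close>

lemma coulomb_c_formula_0_0: "coulomb_c_formula 0 0 L \<eta> = coulomb_c 0 0 L \<eta>"
  if "L > - 3 / 2" "L \<noteq> - 1"
proof -
  have "Gamma (Complex (L + 2) \<eta>) \<noteq> 0"
    using that Complex_notin_nonpos_Ints[of "L + 2" \<eta>] by (simp add: Gamma_eq_zero_iff)
  moreover have "Gamma (2 * L + 3) = (2 * L + 2) * Gamma (2 * L + 2)"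
    using Gamma_plus1_real[of "2 * L + 2"] that by (simp add: algebra_simps)
  moreover have "Gamma (2 * L + 3) > 0" using that by (intro Gamma_real_pos) simp
  moreover have "Gamma 2 = (1 :: real)"
    using Gamma_fact[of 1, where 'a = real] by simp
  ultimately show ?thesis
    using that by (auto simp: coulomb_c_formula_def coulomb_c_def divide_simps power_int_minus)
qed

text \<open>Coefficients of \<open>z ^ (n + 1 - k)\<close> are compared. The guard
  \<open>k \<le> n\<close> matters: by truncated subtraction \<open>coulomb_c (n + 1) n\<close>
  would be the constant coefficient instead of 0.\<close>

lemma coulomb_c_recurrence:
  assumes "L > - 3 / 2" "k \<le> Suc n"
  shows "coulomb_w \<eta> (L + real n + 1) * coulomb_c k (Suc n) L \<eta>
    = (if k \<le> n then coulomb_c k n L \<eta> else 0)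
      - coulomb_lambda \<eta> (L + real n + 1) * (if k = 0 then 0 else coulomb_c (k - 1) n L \<eta>)
      - coulomb_w \<eta> (L + real n) * (if k < 2 then 0 else coulomb_c (k - 2) (n - 1) L \<eta>)"
proof -
  define l where "l = coulomb_lambda \<eta> (L + real n + 1)"
  have w: "coulomb_w \<eta> (L + real n + 1) \<noteq> 0"
    using coulomb_w_pos[of "L + real n + 1" \<eta>] assms by simp
  have P: "smult (coulomb_w \<eta> (L + real n + 1)) (coulomb_P L \<eta> (Suc n))
      = [:- l, 1:] * coulomb_P L \<eta> n
        - (if n = 0 then 0 else smult (coulomb_w \<eta> (L + real n)) (coulomb_P L \<eta> (n - 1)))"
    using w by (cases n) (simp_all add: l_def algebra_simps)
  have "coulomb_w \<eta> (L + real n + 1) * coulomb_c k (Suc n) L \<eta>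
      = coeff (smult (coulomb_w \<eta> (L + real n + 1)) (coulomb_P L \<eta> (Suc n))) (Suc n - k)"
    by (simp add: coulomb_c_def)
  also have "\<dots> = (if k \<le> n then coulomb_c k n L \<eta> else 0) - l * coeff (coulomb_P L \<eta> n) (Suc n - k)
      - (if n = 0 then 0 else coulomb_w \<eta> (L + real n) * coeff (coulomb_P L \<eta> (n - 1)) (Suc n - k))"
    unfolding P using assms(2)
    by (auto simp: coulomb_c_def Suc_diff_le le_Suc_eq)
  also have "coeff (coulomb_P L \<eta> n) (Suc n - k) = (if k = 0 then 0 else coulomb_c (k - 1) n L \<eta>)"
    using degree_coulomb_P_le[of L \<eta> n] by (cases k) (auto simp: coulomb_c_def intro!: coeff_eq_0)
  also have "(if n = 0 then 0 else coulomb_w \<eta> (L + real n) * coeff (coulomb_P L \<eta> (n - 1)) (Suc n - k))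
      = coulomb_w \<eta> (L + real n) * (if k < 2 then 0 else coulomb_c (k - 2) (n - 1) L \<eta>)"
  proof (cases "k < 2")
    case True
    hence "n = 0 \<or> coeff (coulomb_P L \<eta> (n - 1)) (Suc n - k) = 0"
      using degree_coulomb_P_le[of L \<eta> "n - 1"] by (cases n) (auto intro!: coeff_eq_0)
    thus ?thesis using True by auto
  next
    case False
    hence "n \<noteq> 0" "Suc n - k = n - 1 - (k - 2)" using assms(2) by auto
    thus ?thesis using False by (simp add: coulomb_c_def)
  qed
  finally show ?thesis by (simp add: l_def)
qed

lemma coulomb_c_eq_formula:
  assumes "L > - 3 / 2" "L \<noteq> - 1" "k \<le> n"
  shows "coulomb_c k n L \<eta> = coulomb_c_formula k n L \<eta>"
  using assms(3)
proof (induction n arbitrary: k rule: less_induct)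
  case (less n)
  show ?case
  proof (cases n)
    case 0
    thus ?thesis using less.prems coulomb_c_formula_0_0[OF assms(1,2)] by simp
  next
    case (Suc m)
    have k: "k \<le> Suc m" using less.prems Suc by simp
    \<comment> \<open>For \<open>k = m + 1\<close> the formula vanishes through the factor
      \<open>2 * m - 2 * k + 2\<close> of \<open>gamma_factor_base\<close>, matching the guarded
      zero.\<close>
    have "(if k \<le> m then coulomb_c k m L \<eta> else 0) = coulomb_c_formula k m L \<eta>"
    proof (cases "k \<le> m")
      case False
      hence "2 * real m - 2 * real k + 2 = 0" using k by (simp add: le_Suc_eq)
      thus ?thesis using False by (simp add: coulomb_c_formula_eq gamma_factor_base)
    qed (use less.IH[of m k] Suc in simp)
    moreover have "k = 0 \<or> coulomb_c (k - 1) m L \<eta> = coulomb_c_formula (k - 1) m L \<eta>"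
      using less.IH[of m "k - 1"] Suc k by auto
    moreover have "k < 2 \<or> coulomb_c (k - 2) (m - 1) L \<eta> = coulomb_c_formula (k - 2) (m - 1) L \<eta>"
      using less.IH[of "m - 1" "k - 2"] Suc k by auto
    ultimately have "coulomb_w \<eta> (L + real m + 1) * coulomb_c k (Suc m) L \<eta>
        = coulomb_w \<eta> (L + real m + 1) * coulomb_c_formula k (Suc m) L \<eta>"
      unfolding coulomb_c_recurrence[OF assms(1) k] coulomb_c_formula_recurrence[OF k assms(1,2)]
      by auto
    moreover have "coulomb_w \<eta> (L + real m + 1) \<noteq> 0"
      using coulomb_w_pos[of "L + real m + 1" \<eta>] assms(1) by simp
    ultimately show ?thesis by (simp add: Suc)
  qed
qed

section \<open>Continuity in \<open>L\<close> and the limit at \<open>L = - 1\<close>\<close>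

lemma isCont_coulomb_w:
  assumes "L + c > - 1 / 2"
  shows "isCont (\<lambda>M. coulomb_w \<eta> (M + c)) L"
proof -
  have "(2 * (L + c) + 1) * (2 * (L + c) + 3) > 0" using assms by simp
  thus ?thesis
    unfolding coulomb_w_def using assms by (intro continuous_intros) auto
qed

text \<open>For \<open>\<eta> = 0\<close> the terms with \<open>coulomb_lambda\<close>, singular at
  \<open>L = - 1\<close> otherwise, vanish identically. What remains involves
  \<open>coulomb_w\<close> only at arguments above \<open>- 1 / 2\<close>, where it is continuous
  and positive.\<close>

lemma isCont_coeff_coulomb_P:
  assumes "L > - 3 / 2"
  shows "isCont (\<lambda>M. coeff (coulomb_P M 0 n) i) L"
proof (induction n arbitrary: i rule: induct_nat_012)
  case 0
  show ?case by simp
next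
  case 1
  have "isCont (\<lambda>M. coulomb_w 0 (M + 1)) L" "coulomb_w 0 (L + 1) \<noteq> 0"
    using isCont_coulomb_w[of L 1 0] coulomb_w_pos[of "L + 1" 0] assms by simp_all
  hence "isCont (\<lambda>M. 1 / coulomb_w 0 (M + 1) * coeff [:0, 1:] i) L"
    by (intro continuous_intros)
  thus ?case
    by (simp add: coulomb_lambda_def flip: coeff_smult)
next
  case (ge2 n)
  have w: "isCont (\<lambda>M. coulomb_w 0 (M + real (Suc n) + 1)) L" "coulomb_w 0 (L + real (Suc n) + 1) \<noteq> 0"
      "isCont (\<lambda>M. coulomb_w 0 (M + real (Suc n))) L"
    using isCont_coulomb_w[of L "real (Suc n) + 1" 0] isCont_coulomb_w[of L "real (Suc n)" 0]
      coulomb_w_pos[of "L + real (Suc n) + 1" 0] assms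
    by (simp_all add: add.assoc)
  have X: "isCont (\<lambda>M. coeff ([:0, 1:] * coulomb_P M 0 (Suc n)) i) L"
    using ge2(2) by (cases i) (simp_all del: coulomb_P.simps)
  have "coeff (coulomb_P M 0 (Suc (Suc n))) i
      = 1 / coulomb_w 0 (M + real (Suc n) + 1)
        * (coeff ([:0, 1:] * coulomb_P M 0 (Suc n)) i - coulomb_w 0 (M + real (Suc n)) * coeff (coulomb_P M 0 n) i)" for M
    unfolding coulomb_P.simps(3) coulomb_lambda_def by (simp only: coeff_smult coeff_diff) simp
  thus ?case
    using w X ge2(1) by (simp only:) (intro continuous_intros)
qed

theorem proposition10:
  fixes \<eta> L :: real and n k :: nat
  assumes "L > - 3 / 2"
    and "\<eta> \<noteq> 0 \<Longrightarrow> L \<noteq> - 1"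
    and "k \<le> n"
  shows "(L \<noteq> - 1 \<longrightarrow> coulomb_c k n L \<eta> = coulomb_c_formula k n L \<eta>) \<and>
         (L = - 1 \<longrightarrow> ((\<lambda>M. coulomb_c_formula k n M 0) \<longlongrightarrow> coulomb_c k n (- 1) 0) (at (- 1)))"
proof (intro conjI impI)
  assume "L \<noteq> - 1"
  thus "coulomb_c k n L \<eta> = coulomb_c_formula k n L \<eta>"
    using coulomb_c_eq_formula assms(1,3) by blast
next
  have "isCont (\<lambda>M. coulomb_c k n M 0) (- 1)"
    unfolding coulomb_c_def by (rule isCont_coeff_coulomb_P) simp
  hence "((\<lambda>M. coulomb_c k n M 0) \<longlongrightarrow> coulomb_c k n (- 1) 0) (at (- 1))"
    by (simp add: isCont_def)
  \<comment> \<open>The filter is punctured, so the artefact value of the formula at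
    \<open>M = - 1\<close> does not enter.\<close>
  moreover have "\<forall>\<^sub>F M in at (- 1). coulomb_c k n M 0 = coulomb_c_formula k n M 0"
  proof -
    have "\<forall>\<^sub>F M in at (- 1 :: real). M > - 3 / 2"
      by (rule order_tendstoD(1)[OF tendsto_ident_at]) simp
    moreover have "\<forall>\<^sub>F M in at (- 1 :: real). M \<noteq> - 1"
      by (rule eventually_neq_at_within)
    ultimately show ?thesis
      by eventually_elim (use coulomb_c_eq_formula assms(3) in blast)
  qed
  ultimately show "((\<lambda>M. coulomb_c_formula k n M 0) \<longlongrightarrow> coulomb_c k n (- 1) 0) (at (- 1))"
    by (rule Lim_transform_eventually)
qed

end
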